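(* Let $\mathbf{Y}=\mathbf{f}_1+\mathbf{f}_{-1}+\boldsymbol{\epsilon}$ in $\mathbb{R}^n$, where $\mathbf{f}_1,\mathbf{f}_{-1}\in\mathbb{R}^n$ are fixed and $\boldsymbol{\epsilon}$ has i.i.d. $N(0,\sigma^2)$ entries. Let $V_1,V_{-1}$ be linear subspaces of $\mathbb{R}^n$, let $\hat\Pi_1$ be the orthogonal projection of $\mathbb{R}^n$ onto $V_1$, let $\hat\Pi_{-1}:V_1\to V_{-1}$ be a (fixed) linear map, and let $\hat{\mathbf f}_{-1}^{\mathrm{(init)}}$ be an estimator with values in $V_{-1}$. Suppose that for constants $\Delta_1,\Delta_2,\Delta_3>0$, $\rho_1<1$ and a function $\xi:V_{-1}\to\mathbb{R}^+$: (A1) $\|\hat\Pi_{-1}\mathbf g_1\|_{n,2}\le\rho_1\|\mathbf g_1\|_{n,2}$ for all $\mathbf g_1\in V_1$; (A2) $\|(\hat\Pi_1-\hat\Pi_{-1}\hat\Pi_1)^T\mathbf g_{-1}\|_{n,\infty}\le\Delta_1\,\xi(\mathbf g_{-1})$ for all $\mathbf g_{-1}\in V_{-1}$; (A3) $\|\hat\Pi_{-1}\hat\Pi_1\mathbf e_i\|_{n,2}\le\Delta_2/n$ for all $i=1,\dots,n$, where $\mathbf e_i$ is the $i$th standard basis vector of $\mathbb{R}^n$; (A4) $\|\hat\Pi_1y\|_{n,\infty}\le\Delta_3\|y\|_{n,\infty}$ for all $y\in\mathbb{R}^n$. Put $A=(\hat\Pi_{-1}\hat\Pi_1)^T$ and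 $$\hat{\mathbf f}_1^{\mathrm{(pre)}}=(I-A)^{-1}(\hat\Pi_1-A)(\mathbf Y-\hat{\mathbf f}_{-1}^{\mathrm{(init)}}),\qquad \hat{\mathbf f}_1^{\mathrm{(oracle,pre)}}=\hat\Pi_1(\mathbf f_1+\boldsymbol\epsilon).$$ Then for all $\delta>0$, with probability at least $1-\delta$, it holds that $$\|\hat{\mathbf f}_1^{\mathrm{(pre)}}-\hat{\mathbf f}_1^{\mathrm{(oracle,pre)}}\|_{n,\infty}\le\Big(1+\frac{\Delta_2}{1-\rho_1}\Big)\bigg(\sigma\sqrt{\frac{2\log(2n)+2\log(1/\delta)}{n}}+\|\mathbf f_1-\mathbf g_1\|_{n,\infty}+(\Delta_2+\Delta_3)\|\mathbf f_{-1}-\mathbf g_{-1}\|_{n,\infty}+\Delta_1\,\xi\big(\hat{\mathbf f}_{-1}^{\mathrm{(init)}}-\mathbf g_{-1}\big)\bigg)$$ for all $\mathbf g_{-1}\in V_{-1}$ and $\mathbf g_1\in V_1$.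
   Context: For $x\in\mathbb{R}^n$: $\|x\|_{n,\infty}=\max_{1\le i\le n}|x_i|$ and $\|x\|_{n,2}^2=n^{-1}\sum_{i=1}^nx_i^2$. $\hat\Pi_1$ and $\hat\Pi_{-1}\hat\Pi_1$ are identified with their $n\times n$ matrices, and $T$ denotes the matrix transpose; condition (A1) guarantees that $I-A$ is invertible. For $\delta\ge1$ the assertion is vacuous. *)

theory Defs
  imports "HOL-Probability.Probability"
begin

definition norm_n2 :: "real ^ 'n \<Rightarrow> real" where
  "norm_n2 x = sqrt ((\<Sum>i\<in>UNIV. (x $ i)\<^sup>2) / real CARD('n))"

definition orthogonal_projection :: "'a::real_inner set \<Rightarrow> ('a \<Rightarrow> 'a) \<Rightarrow> bool" where
  "orthogonal_projection V P \<longleftrightarrow> (\<forall>x. P x \<in> V \<and> (\<forall>v\<in>V. orthogonal (x - P x) v))"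

(* Linearity of a map between two subspaces; values of f outside V are irrelevant. *)
definition linear_map_between :: "'a::real_vector set \<Rightarrow> 'b::real_vector set \<Rightarrow> ('a \<Rightarrow> 'b) \<Rightarrow> bool" where
  "linear_map_between V W f \<longleftrightarrow>
     (\<forall>x\<in>V. f x \<in> W) \<and>
     (\<forall>x\<in>V. \<forall>y\<in>V. f (x + y) = f x + f y) \<and>
     (\<forall>c. \<forall>x\<in>V. f (c *\<^sub>R x) = c *\<^sub>R f x)"

(* The law N(m, s^2). normal_density m 0 is identically 0, so the degenerate case is treated
   separately as a point mass. *)
definition normal_law :: "real \<Rightarrow> real \<Rightarrow> real measure" where
  "normal_law m s = (if s = 0 then return borel m else density lborel (normal_density m s))"

end

theory Submission
  imports Defs
begin

text \<open>
  Put \<open>B = Pm1 \<circ> P1\<close>, so that \<open>A\<close> is the adjoint of \<open>B\<close>, and \<open>d = fpre - foracle\<close>. Then \<open>d - A d = u - A q\<close> with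
  \<open>u = (P1 - A) (fm1 - finit)\<close> and \<open>q = (I - P1) (f1 + \<epsilon>)\<close>. Solving \<open>w i - B (w i) = B e\<^sub>i\<close> turns this
  into \<open>d $ i = u $ i + w i \<bullet> u - w i \<bullet> q\<close>, where \<open>norm (w i) \<le> \<Delta>\<^sub>2 / ((1 - \<rho>\<^sub>1) * sqrt n)\<close> by the
  contraction property of \<open>B\<close>. The noise enters only through the \<open>n\<close> centred Gaussian variables
  \<open>(w i - P1 (w i)) \<bullet> \<epsilon>\<close>, which are controlled by a Chernoff bound and a union bound.
\<close>

subsection \<open>Norms and orthogonal projections\<close>

lemma norm_n2_eq_norm: "norm_n2 (x :: real ^ 'n) = norm x / sqrt (real CARD('n))"
  by (simp add: norm_n2_def norm_vec_def L2_set_def real_sqrt_divide)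

lemma infnorm_le_iff_cart: "infnorm (x :: real ^ 'n) \<le> c \<longleftrightarrow> (\<forall>i. \<bar>x $ i\<bar> \<le> c)"
proof
  assume "\<forall>i. \<bar>x $ i\<bar> \<le> c"
  then show "infnorm x \<le> c"
    unfolding infnorm_cart by (intro cSup_least) auto
qed (auto intro: order_trans[OF component_le_infnorm_cart])

lemma norm_le_infnorm_cart: "norm (x :: real ^ 'n) \<le> sqrt (real CARD('n)) * infnorm x"
  using norm_le_infnorm[of x] by simp

lemma infnorm_diff_le: "infnorm (x - y) \<le> infnorm x + infnorm y"
  using infnorm_triangle[of x "- y"] by (simp add: infnorm_neg)

text \<open>The factor relating the Euclidean norm to the sup norm cancels the one in the
  hypothesis, so vectors of this size act on the sup norm with a dimension-free constant.\<close>

lemma abs_inner_le_infnorm: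
  fixes w x :: "real ^ 'n"
  assumes "norm w \<le> c / sqrt (real CARD('n))"
  shows "\<bar>w \<bullet> x\<bar> \<le> c * infnorm x"
proof -
  have "\<bar>w \<bullet> x\<bar> \<le> norm w * norm x"
    by (rule Cauchy_Schwarz_ineq2)
  also have "\<dots> \<le> c / sqrt (real CARD('n)) * (sqrt (real CARD('n)) * infnorm x)"
    by (intro mult_mono assms norm_le_infnorm_cart order_trans[OF norm_ge_zero assms]) simp
  also have "\<dots> = c * infnorm x"
    by simp
  finally show ?thesis .
qed

context
  fixes V :: "'a::real_inner set" and P :: "'a \<Rightarrow> 'a"
  assumes V: "subspace V" and P: "orthogonal_projection V P"
begin

lemma orthogonal_projection_in: "P x \<in> V"
  using P by (simp add: orthogonal_projection_def)

lemma orthogonal_projection_residual: "v \<in> V \<Longrightarrow> (x - P x) \<bullet> v = 0"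
  using P by (simp add: orthogonal_projection_def orthogonal_def)

text \<open>Uniqueness of the projection: two candidates differ by a vector of \<open>V\<close> that
  is orthogonal to \<open>V\<close>. Linearity of \<open>P\<close> follows from this
  characterisation.\<close>

lemma orthogonal_projection_eqI:
  assumes "y \<in> V" "\<And>v. v \<in> V \<Longrightarrow> (x - y) \<bullet> v = 0"
  shows "P x = y"
proof -
  let ?d = "P x - y"
  have d: "?d \<in> V"
    by (intro subspace_diff V assms(1) orthogonal_projection_in)
  have "?d \<bullet> ?d = (x - y) \<bullet> ?d - (x - P x) \<bullet> ?d"
    by (simp add: inner_diff_left)
  then show ?thesis
    using assms(2)[OF d] orthogonal_projection_residual[OF d] by simp
qed

lemma orthogonal_projection_linear: "linear P"
proof (rule linearI)
  show "P (x + y) = P x + P y" for x y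
  proof (rule orthogonal_projection_eqI)
    show "P x + P y \<in> V"
      by (intro subspace_add V orthogonal_projection_in)
    show "(x + y - (P x + P y)) \<bullet> v = 0" if "v \<in> V" for v
      using orthogonal_projection_residual[OF that, of x] orthogonal_projection_residual[OF that, of y]
      by (simp add: inner_diff_left inner_add_left)
  qed
  show "P (c *\<^sub>R x) = c *\<^sub>R P x" for c x
  proof (rule orthogonal_projection_eqI)
    show "c *\<^sub>R P x \<in> V"
      by (intro subspace_scale V orthogonal_projection_in)
    show "(c *\<^sub>R x - c *\<^sub>R P x) \<bullet> v = 0" if "v \<in> V" for v
      using orthogonal_projection_residual[OF that, of x] by (simp flip: scaleR_diff_right)
  qed
qed

lemma orthogonal_projection_fixes: "v \<in> V \<Longrightarrow> P v = v"
  by (rule orthogonal_projection_eqI) auto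

lemma orthogonal_projection_adjoint: "P x \<bullet> y = x \<bullet> P y"
proof -
  have "P x \<bullet> y = P x \<bullet> P y"
    using orthogonal_projection_residual[OF orthogonal_projection_in, of y x]
    by (simp add: inner_diff_left inner_commute[of "P x"])
  also have "\<dots> = x \<bullet> P y"
    using orthogonal_projection_residual[OF orthogonal_projection_in, of x y]
    by (simp add: inner_diff_left)
  finally show ?thesis .
qed

lemma orthogonal_projection_pythagoras: "(norm x)\<^sup>2 = (norm (P x))\<^sup>2 + (norm (x - P x))\<^sup>2"
  using norm_add_Pythagorean[of "P x" "x - P x"] orthogonal_projection_residual[OF orthogonal_projection_in, of x x]
  by (simp add: orthogonal_def inner_commute[of "P x"])

lemma orthogonal_projection_norm_le: "norm (P x) \<le> norm x"
  using orthogonal_projection_pythagoras[of x] by (simp add: power2_le_imp_le)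

lemma orthogonal_projection_residual_norm_le: "norm (x - P x) \<le> norm x"
  using orthogonal_projection_pythagoras[of x] by (simp add: power2_le_imp_le)

end

subsection \<open>Resolvent equation of a contraction\<close>

text \<open>The bound on \<open>B\<close> is deliberately in terms of \<open>P x\<close>: for negative \<open>\<rho>\<close> it forces \<open>B = 0\<close>.\<close>

context
  fixes B P :: "'a::euclidean_space \<Rightarrow> 'a" and \<rho> :: real
  assumes B: "linear B" and B_le: "\<And>x. norm (B x) \<le> \<rho> * norm (P x)"
    and P_le: "\<And>x. norm (P x) \<le> norm x" and \<rho>: "\<rho> < 1"
begin

text \<open>Triangle inequality for \<open>w = B v + B w\<close>: for nonnegative
  \<open>\<rho>\<close> the term \<open>\<rho> * norm w\<close> is absorbed on the left. A bound
  through \<open>norm (B v)\<close> lets (A3) enter directly.\<close>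

lemma contraction_resolvent_norm_le:
  assumes "w - B w = B v"
  shows "(1 - \<rho>) * norm w \<le> norm (B v)"
proof (cases "\<rho> \<ge> 0")
  case True
  have "norm w = norm (B v + B w)"
    using assms by (simp add: diff_eq_eq)
  also have "\<dots> \<le> norm (B v) + \<rho> * norm w"
    using True by (intro order_trans[OF norm_triangle_ineq] add_left_mono
        order_trans[OF B_le] mult_left_mono P_le)
  finally show ?thesis
    by (simp add: algebra_simps)
next
  case False
  have "B x = 0" for x
  proof -
    have "\<rho> * norm (P x) \<le> 0"
      using False by (intro mult_nonpos_nonneg) auto
    with B_le[of x] have "norm (B x) \<le> 0"
      by (rule order_trans)
    then show ?thesis
      by simp
  qed
  with assms show ?thesis
    by simp
qed

text \<open>The norm estimate with \<open>v = 0\<close> makes the kernel trivial; in finite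
  dimension injectivity gives surjectivity.\<close>

lemma contraction_resolvent_bij: "bij (\<lambda>x. x - B x)"
proof -
  have lin: "linear (\<lambda>x. x - B x)"
    using B by (intro linear_compose_sub linear_id[unfolded id_def])
  have "inj (\<lambda>x. x - B x)"
    unfolding linear_injective_0[OF lin]
  proof (intro allI impI)
    fix x assume "x - B x = 0"
    then have "(1 - \<rho>) * norm x \<le> 0"
      using contraction_resolvent_norm_le[of x 0] by (simp add: linear_0[OF B])
    then show "x = 0"
      using \<rho> by (simp add: mult_le_0_iff)
  qed
  then show ?thesis
    using lin linear_injective_imp_surjective unfolding bij_def by blast
qed

end

section \<open>Adjoints and resolvents as matrices\<close>

lemma matrix_vector_mul_linear_map:
  fixes B :: "real ^ 'n \<Rightarrow> real ^ 'm"
  assumes "linear B"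
  shows "matrix B *v x = B x"
  by (simp add: matrix_works assms linear_matrix_vector_mul_eq)

lemma inner_transpose_matrix:
  fixes B :: "real ^ 'n \<Rightarrow> real ^ 'm"
  assumes "linear B"
  shows "v \<bullet> (transpose (matrix B) *v y) = B v \<bullet> y"
  by (simp add: dot_lmul_matrix inner_commute[of v] inner_commute[of y] matrix_vector_mul_linear_map[OF assms])

text \<open>Invertibility of \<open>mat 1 - matrix B\<close> passes to its transpose, which makes
  \<open>matrix_inv\<close> a genuine inverse. Stated as an equation so that the inverse matrix can
  be eliminated.\<close>

lemma matrix_inv_transpose_resolvent:
  fixes B :: "real ^ 'n \<Rightarrow> real ^ 'n"
  assumes "linear B" and "bij (\<lambda>x. x - B x)"
  shows "matrix_inv (mat 1 - transpose (matrix B)) *v y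
    - transpose (matrix B) *v (matrix_inv (mat 1 - transpose (matrix B)) *v y) = y"
proof -
  have eq: "(\<lambda>x. (mat 1 - matrix B) *v x) = (\<lambda>x. x - B x)"
    by (simp add: matrix_vector_mult_diff_rdistrib matrix_vector_mul_linear_map[OF assms(1)])
  have "invertible (mat 1 - matrix B)"
    unfolding invertible_eq_bij eq by (rule assms(2))
  then have "invertible (transpose (mat 1 - matrix B))"
    by (rule transpose_invertible)
  moreover have "transpose (mat 1 - matrix B) = mat 1 - transpose (matrix B)"
    by (simp add: transpose_def vec_eq_iff mat_def)
  ultimately have "invertible (mat 1 - transpose (matrix B))"
    by (simp only:)
  then have "(mat 1 - transpose (matrix B)) ** matrix_inv (mat 1 - transpose (matrix B)) = mat 1"
    unfolding matrix_inv_def invertible_def by (rule someI2_ex) blast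
  then have "(mat 1 - transpose (matrix B)) *v (matrix_inv (mat 1 - transpose (matrix B)) *v y) = y"
    by (simp only: matrix_vector_mul_assoc matrix_vector_mul_lid)
  then show ?thesis
    by (simp only: matrix_vector_mult_diff_rdistrib matrix_vector_mul_lid)
qed

text \<open>Write \<open>A\<close> for the transposed matrix of \<open>B\<close>. With
  \<open>e = d - q\<close> the equation becomes \<open>e - A *v e = u - q\<close>, and
  \<open>d $ i - u $ i\<close> is the \<open>i\<close>th entry of \<open>A *v e\<close>. Moving
  \<open>A\<close> to the other side gives \<open>B (axis i 1) \<bullet> e = (w - B w) \<bullet> e =
  w \<bullet> (u - q)\<close>, so a fixed vector replaces the inverse matrix.\<close>

lemma resolvent_solution_component:
  fixes w d u q :: "real ^ 'n" and B :: "real ^ 'n \<Rightarrow> real ^ 'n"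
  assumes "linear B" and w: "w - B w = B (axis i 1)"
    and d: "d - transpose (matrix B) *v d = u - transpose (matrix B) *v q"
  shows "d $ i = u $ i + w \<bullet> u - w \<bullet> q"
proof -
  define e where "e = d - q"
  note adj = inner_transpose_matrix[OF assms(1)]
  have e: "e - transpose (matrix B) *v e = u - q"
    using d by (simp add: e_def matrix_vector_mult_diff_distrib algebra_simps)
  have "d $ i - u $ i = axis i 1 \<bullet> (d - u)"
    by (simp add: inner_axis')
  also have "d - u = transpose (matrix B) *v e"
    using d by (simp add: e_def matrix_vector_mult_diff_distrib algebra_simps)
  also have "axis i 1 \<bullet> \<dots> = (w - B w) \<bullet> e"
    unfolding adj w ..
  also have "\<dots> = w \<bullet> (e - transpose (matrix B) *v e)"
    by (simp only: inner_diff_left inner_diff_right adj)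
  finally show ?thesis
    unfolding e by (simp add: inner_diff_right)
qed

subsection \<open>Gaussian deviation bounds\<close>

text \<open>Completing the square: tilting the centred density by \<open>exp (l * x)\<close> gives a
  constant times the normal density with mean \<open>l * \<sigma>\<^sup>2\<close>, which integrates
  to one.\<close>

lemma nn_integral_exp_normal_density:
  fixes l \<sigma> :: real
  assumes "\<sigma> > 0"
  shows "(\<integral>\<^sup>+x. ennreal (exp (l * x)) \<partial>density lborel (normal_density 0 \<sigma>)) = ennreal (exp (l\<^sup>2 * \<sigma>\<^sup>2 / 2))"
proof -
  have shift: "normal_density 0 \<sigma> x * exp (l * x)
      = exp (l\<^sup>2 * \<sigma>\<^sup>2 / 2) * normal_density (l * \<sigma>\<^sup>2) \<sigma> x" for x
  proof -
    have "- x\<^sup>2 / (2 * \<sigma>\<^sup>2) + l * x = l\<^sup>2 * \<sigma>\<^sup>2 / 2 + - (x - l * \<sigma>\<^sup>2)\<^sup>2 / (2 * \<sigma>\<^sup>2)"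
      using assms by (simp add: field_simps power2_eq_square)
    then show ?thesis
      unfolding normal_density_def by (simp add: exp_add[symmetric] mult_ac)
  qed
  have "(\<integral>\<^sup>+x. ennreal (exp (l * x)) \<partial>density lborel (normal_density 0 \<sigma>))
      = (\<integral>\<^sup>+x. ennreal (exp (l\<^sup>2 * \<sigma>\<^sup>2 / 2)) * ennreal (normal_density (l * \<sigma>\<^sup>2) \<sigma> x) \<partial>lborel)"
    by (subst nn_integral_density) (auto simp: shift simp flip: ennreal_mult')
  also have "\<dots> = ennreal (exp (l\<^sup>2 * \<sigma>\<^sup>2 / 2)) * (\<integral>\<^sup>+x. ennreal (normal_density (l * \<sigma>\<^sup>2) \<sigma> x) \<partial>lborel)"
    by (rule nn_integral_cmult) auto
  also have "(\<integral>\<^sup>+x. ennreal (normal_density (l * \<sigma>\<^sup>2) \<sigma> x) \<partial>lborel) = 1"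
    using prob_space.emeasure_space_1[OF prob_space_normal_density[OF assms, of "l * \<sigma>\<^sup>2"]]
    by (simp add: emeasure_density)
  finally show ?thesis
    by simp
qed

text \<open>Chernoff bound: by independence the moment generating function factorises, so only the
  sum of squared weights matters. An upper bound \<open>s\<^sup>2\<close> on that sum with
  \<open>s > 0\<close> also covers zero weights.\<close>

lemma (in prob_space) normal_linear_combination_tail:
  fixes X :: "'i \<Rightarrow> 'a \<Rightarrow> real" and v :: "'i \<Rightarrow> real"
  assumes "finite I" and indep: "indep_vars (\<lambda>_. borel) X I"
    and distr: "\<And>i. i \<in> I \<Longrightarrow> distr M borel (X i) = density lborel (normal_density 0 \<sigma>)"
    and "\<sigma> > 0" "s > 0" "t > 0" and v: "(\<Sum>i\<in>I. (v i)\<^sup>2) \<le> s\<^sup>2"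
  shows "prob {\<omega>\<in>space M. (\<Sum>i\<in>I. v i * X i \<omega>) \<ge> \<sigma> * (s * t)} \<le> exp (- t\<^sup>2 / 2)"
proof -
  \<comment> \<open>Minimiser of the exponent \<open>l\<^sup>2 * \<sigma>\<^sup>2 * s\<^sup>2 / 2 -
    l * \<sigma> * s * t\<close>, with minimum \<open>- t\<^sup>2 / 2\<close>.\<close>
  define l where "l = t / (\<sigma> * s)"
  have l: "l > 0"
    using assms by (simp add: l_def)
  have rv [measurable]: "X i \<in> borel_measurable M" if "i \<in> I" for i
    using indep that by (auto simp: indep_vars_def)
  have mgf: "(\<integral>\<^sup>+\<omega>. ennreal (exp (l * v i * X i \<omega>)) \<partial>M) = ennreal (exp ((l * v i)\<^sup>2 * \<sigma>\<^sup>2 / 2))" if "i \<in> I" for i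
  proof -
    have "(\<integral>\<^sup>+\<omega>. ennreal (exp (l * v i * X i \<omega>)) \<partial>M) = (\<integral>\<^sup>+x. ennreal (exp (l * v i * x)) \<partial>distr M borel (X i))"
      using that by (subst nn_integral_distr) auto
    then show ?thesis
      using that by (simp add: distr nn_integral_exp_normal_density[OF \<open>\<sigma> > 0\<close>])
  qed
  let ?S = "\<lambda>\<omega>. \<Sum>i\<in>I. v i * X i \<omega>"
  have "(\<integral>\<^sup>+\<omega>. ennreal (exp (l * ?S \<omega>)) \<partial>M) = (\<integral>\<^sup>+\<omega>. (\<Prod>i\<in>I. ennreal (exp (l * v i * X i \<omega>))) \<partial>M)"
    using \<open>finite I\<close> by (simp add: sum_distrib_left exp_sum prod_ennreal mult.assoc)
  also have "\<dots> = (\<Prod>i\<in>I. \<integral>\<^sup>+\<omega>. ennreal (exp (l * v i * X i \<omega>)) \<partial>M)"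
    by (intro indep_vars_nn_integral \<open>finite I\<close> indep_vars_compose2[OF indep]) auto
  also have "\<dots> = (\<Prod>i\<in>I. ennreal (exp ((l * v i)\<^sup>2 * \<sigma>\<^sup>2 / 2)))"
    by (intro prod.cong refl mgf)
  also have "\<dots> = ennreal (exp (l\<^sup>2 * \<sigma>\<^sup>2 / 2 * (\<Sum>i\<in>I. (v i)\<^sup>2)))"
    using \<open>finite I\<close> by (simp add: prod_ennreal sum_distrib_left power_mult_distrib mult_ac flip: exp_sum)
  also have "\<dots> \<le> ennreal (exp (l\<^sup>2 * \<sigma>\<^sup>2 / 2 * s\<^sup>2))"
    by (intro ennreal_leI) (simp add: mult_left_mono v)
  also have "l\<^sup>2 * \<sigma>\<^sup>2 / 2 * s\<^sup>2 = t\<^sup>2 / 2"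
    using assms by (simp add: l_def power_divide power_mult_distrib)
  finally have mgf_sum: "(\<integral>\<^sup>+\<omega>. ennreal (exp (l * ?S \<omega>)) \<partial>M) \<le> ennreal (exp (t\<^sup>2 / 2))" .
  have "emeasure M {\<omega>\<in>space M. ?S \<omega> \<ge> \<sigma> * (s * t)}
      \<le> ennreal (exp (- l * (\<sigma> * (s * t)))) * (\<integral>\<^sup>+\<omega>. ennreal (exp (l * ?S \<omega>)) * indicator (space M) \<omega> \<partial>M)"
    by (rule Chernoff_ineq_nn_integral_ge[OF l]) measurable
  also have "(\<integral>\<^sup>+\<omega>. ennreal (exp (l * ?S \<omega>)) * indicator (space M) \<omega> \<partial>M) = (\<integral>\<^sup>+\<omega>. ennreal (exp (l * ?S \<omega>)) \<partial>M)"
    by (intro nn_integral_cong) simp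
  also have "ennreal (exp (- l * (\<sigma> * (s * t)))) * \<dots> \<le> ennreal (exp (- t\<^sup>2)) * ennreal (exp (t\<^sup>2 / 2))"
    using assms mgf_sum by (intro mult_mono) (auto simp: l_def power2_eq_square)
  also have "\<dots> = ennreal (exp (- t\<^sup>2 / 2))"
    by (simp add: field_simps flip: ennreal_mult' exp_add)
  finally show ?thesis
    by (simp add: emeasure_eq_measure)
qed

text \<open>Union bound over the \<open>2 * card J\<close> one-sided tails; the combinations for
  different \<open>j\<close> may depend on each other arbitrarily.\<close>

lemma (in prob_space) normal_linear_combinations_uniform_bound:
  fixes X :: "'i \<Rightarrow> 'a \<Rightarrow> real" and v :: "'j \<Rightarrow> 'i \<Rightarrow> real"
  assumes "finite I" "finite J" "J \<noteq> {}" and indep: "indep_vars (\<lambda>_. borel) X I"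
    and distr: "\<And>i. i \<in> I \<Longrightarrow> distr M borel (X i) = normal_law 0 \<sigma>"
    and "\<sigma> \<ge> 0" "s > 0" and v: "\<And>j. j \<in> J \<Longrightarrow> (\<Sum>i\<in>I. (v j i)\<^sup>2) \<le> s\<^sup>2"
    and \<delta>: "0 < \<delta>" "\<delta> \<le> 1"
  shows "\<exists>E\<in>sets M. prob E \<ge> 1 - \<delta> \<and> (\<forall>\<omega>\<in>E. \<forall>j\<in>J. \<bar>\<Sum>i\<in>I. v j i * X i \<omega>\<bar>
    \<le> \<sigma> * (s * sqrt (2 * ln (2 * real (card J)) + 2 * ln (1 / \<delta>))))"
proof (cases "\<sigma> = 0")
  case True
  have rv [measurable]: "X i \<in> borel_measurable M" if "i \<in> I" for i
    using indep that by (auto simp: indep_vars_def)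
  \<comment> \<open>A point mass at zero makes all \<open>X i\<close> vanish almost surely, and both
    sides of the claimed bound are then zero.\<close>
  let ?E = "{\<omega>\<in>space M. \<forall>i\<in>I. X i \<omega> = 0}"
  have "AE \<omega> in M. X i \<omega> = 0" if "i \<in> I" for i
  proof -
    have "AE x in distr M borel (X i). x = 0"
      unfolding distr[OF that] normal_law_def using True by (simp add: AE_return)
    then show ?thesis
      using that by (simp add: AE_distr_iff)
  qed
  then have "AE \<omega> in M. \<forall>i\<in>I. X i \<omega> = 0"
    using \<open>finite I\<close> by (simp add: AE_finite_all)
  moreover have E: "?E \<in> sets M"
    using \<open>finite I\<close> by measurable
  ultimately have "prob ?E = 1"
    by (simp add: prob_Collect_eq_1)
  with True E \<delta> show ?thesis
    by (intro bexI[of _ ?E]) auto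
next
  case False
  then have \<sigma>: "\<sigma> > 0"
    using \<open>\<sigma> \<ge> 0\<close> by simp
  have rv [measurable]: "X i \<in> borel_measurable M" if "i \<in> I" for i
    using indep that by (auto simp: indep_vars_def)
  \<comment> \<open>Chosen so that the total failure probability
    \<open>2 * card J * exp (- t\<^sup>2 / 2)\<close> equals \<open>\<delta>\<close>.\<close>
  define t where "t = sqrt (2 * ln (2 * real (card J)) + 2 * ln (1 / \<delta>))"
  have J: "real (card J) \<ge> 1"
    using \<open>finite J\<close> \<open>J \<noteq> {}\<close> by (simp add: Suc_le_eq card_gt_0_iff)
  \<comment> \<open>The factor 2 inside the logarithm keeps this strictly positive even for
    \<open>card J = 1\<close> and \<open>\<delta> = 1\<close>.\<close>
  have pos: "2 * ln (2 * real (card J)) + 2 * ln (1 / \<delta>) > 0"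
    using J \<delta> by (intro add_pos_nonneg) auto
  then have t: "t > 0"
    by (simp add: t_def)
  have exp_t: "2 * real (card J) * exp (- t\<^sup>2 / 2) = \<delta>"
  proof -
    have "t\<^sup>2 / 2 = ln (2 * real (card J) / \<delta>)"
      using pos J \<delta> by (simp add: t_def ln_div ln_mult)
    then show ?thesis
      using J \<delta> by (simp add: exp_minus)
  qed
  define S where "S j \<omega> = (\<Sum>i\<in>I. v j i * X i \<omega>)" for j \<omega>
  have S [measurable]: "S j \<in> borel_measurable M" for j
    unfolding S_def by measurable
  define T where "T j = {\<omega>\<in>space M. \<sigma> * (s * t) \<le> S j \<omega>} \<union> {\<omega>\<in>space M. \<sigma> * (s * t) \<le> - S j \<omega>}" for j
  have T [measurable]: "T j \<in> sets M" for j
    unfolding T_def by measurable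
  have nd: "\<And>i. i \<in> I \<Longrightarrow> distr M borel (X i) = density lborel (normal_density 0 \<sigma>)"
    using distr False by (simp add: normal_law_def)
  have T_le: "prob (T j) \<le> 2 * exp (- t\<^sup>2 / 2)" if "j \<in> J" for j
  proof -
    have "prob (T j) \<le> prob {\<omega>\<in>space M. \<sigma> * (s * t) \<le> S j \<omega>} + prob {\<omega>\<in>space M. \<sigma> * (s * t) \<le> - S j \<omega>}"
      unfolding T_def by (intro measure_Un_le) measurable
    also have "\<dots> \<le> exp (- t\<^sup>2 / 2) + exp (- t\<^sup>2 / 2)"
    proof (rule add_mono)
      show "prob {\<omega>\<in>space M. \<sigma> * (s * t) \<le> S j \<omega>} \<le> exp (- t\<^sup>2 / 2)"
        unfolding S_def
        by (rule normal_linear_combination_tail[OF \<open>finite I\<close> indep nd \<sigma> \<open>s > 0\<close> t v[OF that]])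
      have "(\<Sum>i\<in>I. (- v j i)\<^sup>2) \<le> s\<^sup>2"
        using v[OF that] by simp
      from normal_linear_combination_tail[OF \<open>finite I\<close> indep nd \<sigma> \<open>s > 0\<close> t this]
      show "prob {\<omega>\<in>space M. \<sigma> * (s * t) \<le> - S j \<omega>} \<le> exp (- t\<^sup>2 / 2)"
        by (simp add: S_def sum_negf)
    qed
    finally show ?thesis
      by simp
  qed
  let ?E = "space M - (\<Union>j\<in>J. T j)"
  have UT [measurable]: "(\<Union>j\<in>J. T j) \<in> sets M"
    using \<open>finite J\<close> by (intro sets.finite_UN) auto
  have "prob (\<Union>j\<in>J. T j) \<le> (\<Sum>j\<in>J. prob (T j))"
    using \<open>finite J\<close> by (intro measure_UNION_le) auto
  also have "\<dots> \<le> (\<Sum>j\<in>J. 2 * exp (- t\<^sup>2 / 2))"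
    by (intro sum_mono T_le)
  also have "\<dots> = \<delta>"
    using exp_t by simp
  finally have "prob ?E \<ge> 1 - \<delta>"
    by (simp add: prob_compl[OF UT])
  moreover have "\<bar>S j \<omega>\<bar> \<le> \<sigma> * (s * t)" if "\<omega> \<in> ?E" "j \<in> J" for j \<omega>
    using that by (auto simp: T_def abs_le_iff not_le less_imp_le)
  ultimately show ?thesis
    unfolding S_def t_def by (intro bexI[of _ ?E]) auto
qed

subsection \<open>The comparison with the oracle\<close>

theorem theorem1:
  fixes M :: "'w measure"
    and f1 fm1 :: "real ^ 'n"
    and \<epsilon> Y finit fpre foracle :: "'w \<Rightarrow> real ^ 'n"
    and V1 Vm1 :: "(real ^ 'n) set"
    and P1 Pm1 :: "real ^ 'n \<Rightarrow> real ^ 'n"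
    and A :: "real ^ 'n ^ 'n"
    and \<xi> :: "real ^ 'n \<Rightarrow> real"
    and \<sigma> \<Delta>\<^sub>1 \<Delta>\<^sub>2 \<Delta>\<^sub>3 \<rho>\<^sub>1 \<delta> :: real
  assumes M: "prob_space M"
    and sigma: "\<sigma> \<ge> 0"
    and noise_indep: "prob_space.indep_vars M (\<lambda>_. borel) (\<lambda>i \<omega>. \<epsilon> \<omega> $ i) UNIV"
    and noise_normal: "\<And>i. distr M borel (\<lambda>\<omega>. \<epsilon> \<omega> $ i) = normal_law 0 \<sigma>"
    and Y: "\<And>\<omega>. Y \<omega> = f1 + fm1 + \<epsilon> \<omega>"
    and V1: "subspace V1"
    and Vm1: "subspace Vm1"
    and P1: "orthogonal_projection V1 P1"
    and Pm1: "linear_map_between V1 Vm1 Pm1"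
    and finit_rv: "finit \<in> borel_measurable M"
    and finit_Vm1: "\<And>\<omega>. \<omega> \<in> space M \<Longrightarrow> finit \<omega> \<in> Vm1"
    and constants: "\<Delta>\<^sub>1 > 0" "\<Delta>\<^sub>2 > 0" "\<Delta>\<^sub>3 > 0" "\<rho>\<^sub>1 < 1"
    and xi: "\<And>g. g \<in> Vm1 \<Longrightarrow> \<xi> g \<ge> 0"
    and A1: "\<And>g. g \<in> V1 \<Longrightarrow> norm_n2 (Pm1 g) \<le> \<rho>\<^sub>1 * norm_n2 g"
    and A2: "\<And>g. g \<in> Vm1 \<Longrightarrow>
               infnorm (transpose (matrix P1 - matrix (Pm1 \<circ> P1)) *v g) \<le> \<Delta>\<^sub>1 * \<xi> g"
    and A3: "\<And>i. norm_n2 (Pm1 (P1 (axis i 1))) \<le> \<Delta>\<^sub>2 / real CARD('n)"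
    and A4: "\<And>y. infnorm (P1 y) \<le> \<Delta>\<^sub>3 * infnorm y"
    and A: "A = transpose (matrix (Pm1 \<circ> P1))"
    and fpre: "\<And>\<omega>. fpre \<omega> = matrix_inv (mat 1 - A) *v ((matrix P1 - A) *v (Y \<omega> - finit \<omega>))"
    and foracle: "\<And>\<omega>. foracle \<omega> = P1 (f1 + \<epsilon> \<omega>)"
    and delta: "\<delta> > 0"
  shows "\<exists>E \<in> sets M. measure M E \<ge> 1 - \<delta> \<and>
    (\<forall>\<omega>\<in>E. \<forall>gm1\<in>Vm1. \<forall>g1\<in>V1.
       infnorm (fpre \<omega> - foracle \<omega>)
       \<le> (1 + \<Delta>\<^sub>2 / (1 - \<rho>\<^sub>1)) *
         (\<sigma> * sqrt ((2 * ln (2 * real CARD('n)) + 2 * ln (1 / \<delta>)) / real CARD('n))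
          + infnorm (f1 - g1)
          + (\<Delta>\<^sub>2 + \<Delta>\<^sub>3) * infnorm (fm1 - gm1)
          + \<Delta>\<^sub>1 * \<xi> (finit \<omega> - gm1)))"
proof (cases "\<delta> \<le> 1")
  \<comment> \<open>Here \<open>1 - \<delta>\<close> is negative, so the empty event
    suffices.\<close>
  case False
  then show ?thesis
    by (intro bexI[of _ "{}"]) auto
next
  case True
  interpret prob_space M by (rule M)
  let ?n = "real CARD('n)"

  \<comment> \<open>The composed map and its resolvent vectors\<close>
  define B where "B = Pm1 \<circ> P1"
  define c where "c = \<Delta>\<^sub>2 / (1 - \<rho>\<^sub>1)"
  have c: "c > 0"
    using constants by (simp add: c_def)
  note P1_in = orthogonal_projection_in[OF V1 P1]
  note P1_lin = orthogonal_projection_linear[OF V1 P1]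
  note P1_adj = orthogonal_projection_adjoint[OF V1 P1]
  note P1_fix = orthogonal_projection_fixes[OF V1 P1]
  \<comment> \<open>\<open>Pm1\<close> is linear only on \<open>V1\<close>, but \<open>P1\<close>
    maps into \<open>V1\<close>, so the composition is linear on the whole space.\<close>
  have B_lin: "linear B"
  proof (rule linearI)
    show "B (x + y) = B x + B y" for x y
      using Pm1 P1_in by (simp add: B_def linear_map_between_def linear_add[OF P1_lin])
    show "B (a *\<^sub>R x) = a *\<^sub>R B x" for a x
      using Pm1 P1_in by (simp add: B_def linear_map_between_def linear_scale[OF P1_lin])
  qed
  \<comment> \<open>The common factor of the normalised norms cancels in (A1). Keeping
    \<open>P1 x\<close> on the right retains the case of negative
    \<open>\<rho>\<^sub>1\<close>.\<close>
  have B_le: "norm (B x) \<le> \<rho>\<^sub>1 * norm (P1 x)" for x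
    using A1[OF P1_in[of x]] by (simp add: norm_n2_eq_norm B_def divide_le_cancel)
  note P1_le = orthogonal_projection_norm_le[OF V1 P1]
  note bij = contraction_resolvent_bij[OF B_lin B_le P1_le \<open>\<rho>\<^sub>1 < 1\<close>]
  have A_B: "A = transpose (matrix B)"
    by (simp add: A B_def)
  have A_adj: "x \<bullet> (A *v y) = B x \<bullet> y" for x y
    unfolding A_B by (rule inner_transpose_matrix[OF B_lin])
  have P1_mat: "matrix P1 *v x = P1 x" for x
    by (rule matrix_vector_mul_linear_map[OF P1_lin])

  have "\<exists>w. w - B w = B (axis i 1)" for i
    using bij by (metis bij_pointE)
  \<comment> \<open>These vectors depend only on the fixed maps, not on \<open>\<omega>\<close>, so
    their pairings with the noise are linear combinations with deterministic weights.\<close>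
  then obtain w where w: "w i - B (w i) = B (axis i 1)" for i
    by metis
  have Be_le: "norm (B (axis i 1)) \<le> \<Delta>\<^sub>2 / sqrt ?n" for i
  proof -
    have "norm (B (axis i 1)) / sqrt ?n \<le> \<Delta>\<^sub>2 / ?n"
      using A3[of i] by (simp add: norm_n2_eq_norm B_def)
    then have "norm (B (axis i 1)) \<le> \<Delta>\<^sub>2 / ?n * sqrt ?n"
      by (simp add: divide_le_eq)
    also have "\<dots> = \<Delta>\<^sub>2 * (sqrt ?n / ?n)"
      by simp
    also have "sqrt ?n / ?n = 1 / sqrt ?n"
      by (simp add: sqrt_divide_self_eq inverse_eq_divide)
    finally show ?thesis
      by simp
  qed
  have w_le: "norm (w i) \<le> c / sqrt ?n" for i
  proof -
    have "(1 - \<rho>\<^sub>1) * norm (w i) \<le> \<Delta>\<^sub>2 / sqrt ?n"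
      using contraction_resolvent_norm_le[OF B_lin B_le P1_le \<open>\<rho>\<^sub>1 < 1\<close> w] Be_le[of i] by (rule order_trans)
    then show ?thesis
      using \<open>\<rho>\<^sub>1 < 1\<close> by (simp add: c_def field_simps)
  qed
  \<comment> \<open>The \<open>i\<close>th row of \<open>A\<close> is \<open>B (axis i 1)\<close>,
    so (A3) controls \<open>A\<close> in the sup norm with a dimension-free constant.\<close>
  have A_le: "infnorm (A *v x) \<le> \<Delta>\<^sub>2 * infnorm x" for x
    unfolding infnorm_le_iff_cart
  proof
    fix i
    have "(A *v x) $ i = B (axis i 1) \<bullet> x"
      unfolding A_adj[symmetric] by (simp add: inner_axis')
    then show "\<bar>(A *v x) $ i\<bar> \<le> \<Delta>\<^sub>2 * infnorm x"
      using abs_inner_le_infnorm[OF Be_le] by simp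
  qed

  \<comment> \<open>The noise event\<close>
  define v where "v i = w i - P1 (w i)" for i
  note residual_le = orthogonal_projection_residual_norm_le[OF V1 P1]
  have v_le: "norm (v i) \<le> c / sqrt ?n" for i
    unfolding v_def using residual_le w_le by (rule order_trans)
  define \<tau> where "\<tau> = \<sigma> * sqrt ((2 * ln (2 * ?n) + 2 * ln (1 / \<delta>)) / ?n)"
  have "?n \<ge> 1"
    by (simp add: Suc_le_eq)
  then have n2: "2 * ?n \<ge> 1"
    by linarith
  \<comment> \<open>Nonnegativity is what permits enlarging \<open>c * \<tau>\<close> to
    \<open>(1 + c) * \<tau>\<close> in the final estimate.\<close>
  have \<tau>: "\<tau> \<ge> 0"
    unfolding \<tau>_def using n2 True sigma delta
    by (intro mult_nonneg_nonneg real_sqrt_ge_zero divide_nonneg_nonneg add_nonneg_nonneg ln_ge_zero)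
      simp_all
  have v_sq: "(\<Sum>j\<in>UNIV. (v i $ j)\<^sup>2) \<le> (c / sqrt ?n)\<^sup>2" for i
    using power_mono[OF v_le[of i] norm_ge_zero, of 2]
    by (simp add: norm_vec_def L2_set_def sum_nonneg)
  have "c / sqrt ?n > 0"
    using c by simp
  \<comment> \<open>Applied with \<open>s = c / sqrt ?n\<close> and one combination per coordinate,
    hence the logarithm of \<open>2 * ?n\<close>. The bound on \<open>E\<close> concerns only the
    noise, so \<open>finit\<close> may depend on the noise in any way.\<close>
  from normal_linear_combinations_uniform_bound[OF finite finite UNIV_not_empty noise_indep
      noise_normal sigma this, of "\<lambda>i j. v i $ j", OF v_sq delta True]
  obtain E where E: "E \<in> sets M" "prob E \<ge> 1 - \<delta>"
    and E_noise: "\<And>\<omega> i. \<omega> \<in> E \<Longrightarrow> \<bar>\<Sum>j\<in>UNIV. v i $ j * \<epsilon> \<omega> $ j\<bar>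
      \<le> \<sigma> * (c / sqrt ?n * sqrt (2 * ln (2 * ?n) + 2 * ln (1 / \<delta>)))"
    by blast
  have noise: "\<bar>v i \<bullet> \<epsilon> \<omega>\<bar> \<le> c * \<tau>" if "\<omega> \<in> E" for \<omega> i
    using E_noise[OF that, of i] by (simp add: inner_vec_def \<tau>_def real_sqrt_divide mult_ac)

  \<comment> \<open>The deterministic estimate on the noise event\<close>
  have main: "infnorm (fpre \<omega> - foracle \<omega>)
      \<le> (1 + c) * (\<tau> + infnorm (f1 - g1) + (\<Delta>\<^sub>2 + \<Delta>\<^sub>3) * infnorm (fm1 - gm1)
          + \<Delta>\<^sub>1 * \<xi> (finit \<omega> - gm1))"
    if "\<omega> \<in> E" and gm1: "gm1 \<in> Vm1" and g1: "g1 \<in> V1" for \<omega> gm1 g1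
  proof -
    define b where "b = (\<Delta>\<^sub>2 + \<Delta>\<^sub>3) * infnorm (fm1 - gm1) + \<Delta>\<^sub>1 * \<xi> (finit \<omega> - gm1)"
    define x where "x = f1 + \<epsilon> \<omega>"
    define d where "d = fpre \<omega> - P1 x"
    define u where "u = P1 (fm1 - finit \<omega>) - A *v (fm1 - finit \<omega>)"
    have "\<omega> \<in> space M"
      using \<open>\<omega> \<in> E\<close> E(1) sets.sets_into_space by blast
    then have mem: "finit \<omega> - gm1 \<in> Vm1"
      by (intro subspace_diff Vm1 finit_Vm1 gm1)
    have "fpre \<omega> - A *v fpre \<omega> = (matrix P1 - A) *v (Y \<omega> - finit \<omega>)"
      unfolding fpre A_B by (rule matrix_inv_transpose_resolvent[OF B_lin bij])
    also have "Y \<omega> - finit \<omega> = x + (fm1 - finit \<omega>)"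
      by (simp add: Y x_def)
    \<comment> \<open>The contribution of \<open>x\<close> is \<open>P1 x - A *v x\<close>; removing
      \<open>P1 x - A *v P1 x\<close> for the oracle leaves only
      \<open>- A *v (x - P1 x)\<close>.\<close>
    finally have "d - A *v d = u - A *v (x - P1 x)"
      by (simp add: d_def u_def matrix_vector_mult_diff_rdistrib matrix_vector_mult_diff_distrib
          matrix_vector_right_distrib P1_mat linear_add[OF P1_lin] linear_diff[OF P1_lin] algebra_simps)
    then have comp: "d $ i = u $ i + w i \<bullet> u - w i \<bullet> (x - P1 x)" for i
      using resolvent_solution_component[OF B_lin w] unfolding A_B by blast
    \<comment> \<open>The residual map of \<open>P1\<close> is self-adjoint, so it moves onto
      \<open>w i\<close> and yields \<open>v i\<close>; since it kills \<open>V1\<close>, any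
      \<open>g1\<close> may be subtracted from \<open>f1\<close>.\<close>
    have resid: "w i \<bullet> (x - P1 x) = v i \<bullet> (f1 - g1) + v i \<bullet> \<epsilon> \<omega>" for i
    proof -
      have "x - P1 x = ((f1 - g1) - P1 (f1 - g1)) + (\<epsilon> \<omega> - P1 (\<epsilon> \<omega>))"
        by (simp add: x_def linear_add[OF P1_lin] linear_diff[OF P1_lin] P1_fix[OF g1])
      then show ?thesis
        by (simp add: v_def inner_diff_left inner_diff_right inner_add_right P1_adj linear_diff[OF P1_lin])
    qed
    \<comment> \<open>Splitting at \<open>gm1\<close>: (A3) and (A4) bound the approximation error
      \<open>fm1 - gm1\<close>, while (A2) applies to \<open>finit \<omega> - gm1\<close>, which
      lies in \<open>Vm1\<close>.\<close>
    have u_le: "infnorm u \<le> b"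
    proof -
      let ?a = "fm1 - gm1" and ?h = "finit \<omega> - gm1"
      have "u = (P1 ?a - A *v ?a) - (P1 ?h - A *v ?h)"
        by (simp add: u_def linear_diff[OF P1_lin] matrix_vector_mult_diff_distrib)
      then have "infnorm u \<le> infnorm (P1 ?a - A *v ?a) + infnorm (P1 ?h - A *v ?h)"
        by (simp only: infnorm_diff_le)
      also have "\<dots> \<le> (infnorm (P1 ?a) + infnorm (A *v ?a)) + infnorm (P1 ?h - A *v ?h)"
        by (intro add_right_mono infnorm_diff_le)
      finally have "infnorm u \<le> (infnorm (P1 ?a) + infnorm (A *v ?a)) + infnorm (P1 ?h - A *v ?h)" .
      moreover have "infnorm (P1 ?h - A *v ?h) \<le> \<Delta>\<^sub>1 * \<xi> ?h"
      proof -
        \<comment> \<open>(A2) concerns the transposed matrix of \<open>P1\<close> minus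
          \<open>A\<close>; self-adjointness of \<open>P1\<close> removes the transpose.\<close>
        have "transpose (matrix P1) *v ?h = P1 ?h"
          by (rule vector_eq_ldot[THEN iffD1])
            (simp only: inner_transpose_matrix[OF P1_lin] P1_adj simp_thms)
        moreover have "transpose (matrix P1 - matrix (Pm1 \<circ> P1)) = transpose (matrix P1) - A"
          by (simp add: A transpose_def vec_eq_iff)
        ultimately have "transpose (matrix P1 - matrix (Pm1 \<circ> P1)) *v ?h = P1 ?h - A *v ?h"
          by (simp only: matrix_vector_mult_diff_rdistrib)
        then show ?thesis
          using A2[OF mem] by (simp only:)
      qed
      moreover have "(\<Delta>\<^sub>2 + \<Delta>\<^sub>3) * infnorm ?a = \<Delta>\<^sub>3 * infnorm ?a + \<Delta>\<^sub>2 * infnorm ?a"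
        by (simp add: distrib_right)
      ultimately show ?thesis
        using A4[of ?a] A_le[of ?a] unfolding b_def by linarith
    qed
    have "infnorm d \<le> (1 + c) * (\<tau> + infnorm (f1 - g1) + b)"
      unfolding infnorm_le_iff_cart
    proof
      fix i
      have "\<bar>d $ i\<bar> \<le> \<bar>u $ i\<bar> + \<bar>w i \<bullet> u\<bar> + \<bar>v i \<bullet> (f1 - g1)\<bar> + \<bar>v i \<bullet> \<epsilon> \<omega>\<bar>"
        unfolding comp resid by linarith
      also have "\<dots> \<le> b + c * b + c * infnorm (f1 - g1) + c * \<tau>"
      proof (intro add_mono)
        show "\<bar>u $ i\<bar> \<le> b"
          using component_le_infnorm_cart u_le by (rule order_trans)
        show "\<bar>w i \<bullet> u\<bar> \<le> c * b"
          using c by (intro order_trans[OF abs_inner_le_infnorm[OF w_le]] mult_left_mono u_le) simp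
        show "\<bar>v i \<bullet> (f1 - g1)\<bar> \<le> c * infnorm (f1 - g1)"
          by (rule abs_inner_le_infnorm[OF v_le])
        show "\<bar>v i \<bullet> \<epsilon> \<omega>\<bar> \<le> c * \<tau>"
          by (rule noise[OF \<open>\<omega> \<in> E\<close>])
      qed
      \<comment> \<open>The \<open>b\<close> terms match exactly; the other two go from factor
        \<open>c\<close> to \<open>1 + c\<close>.\<close>
      also have "\<dots> \<le> (1 + c) * (\<tau> + infnorm (f1 - g1) + b)"
        using \<tau> infnorm_pos_le[of "f1 - g1"] by (simp add: algebra_simps)
      finally show "\<bar>d $ i\<bar> \<le> (1 + c) * (\<tau> + infnorm (f1 - g1) + b)" .
    qed
    then show ?thesis
      by (simp add: d_def x_def foracle b_def add.assoc)
  qed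
  show ?thesis
    using E main unfolding \<tau>_def c_def by (intro bexI[of _ E]) blast+
qed

end
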